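(* For every integer $\ell\ge 0$ and every integer $n\ge 1$, the following identity holds in $\mathbb{C}[z]$: $$q_{\ell,n}(z) = \prod_{k\mid n}\left( h_k(z)^{\eta_\ell(k)} \prod_{j=2}^{\ell} m_{j,k}(z)\right),$$ where the outer product runs over all positive divisors $k$ of $n$ and the multiplicity $\eta_\ell(k)$ is given by $$\eta_\ell(k) = \left\lfloor \frac{\ell-1}{k}\right\rfloor + 2 .$$ In other words, the roots of $q_{\ell,n}$ are composed of the points of $\operatorname{Hyp}(k)$ for any divisor $k$ of $n$, which are roots with multiplicity $\eta_\ell(k)$, and of the points of $\operatorname{Mis}(j,k)$ for $2\le j\le \ell$ and any divisor $k$ of $n$, which are simple roots.
   Context: Define polynomials $p_n\in\mathbb{Z}[z]$ recursively by $p_0(z)=0$ and $p_{n+1}(z)=p_n(z)^2+z$ for $n\ge 0$. For integers $\ell, n\ge 0$ put $q_{\ell,n}(z)=p_{\ell+n}(z)-p_\ell(z)$. For $n\ge 1$, let $\operatorname{Div}(n)^\ast$ be the set of positive divisors $k$ of $n$ with $k\neq n$. For $n\ge 1$, define the finite set $$\operatorname{Hyp}(n)=\{z\in\mathbb{C} : p_n(z)=0 \text{ and } p_k(z)\ne 0 \text{ for all } k\in \operatorname{Div}(n)^\ast\}$$ and the polynomial $h_n(z)=\prod_{r\in \operatorname{Hyp}(n)}(z-r)$. For $\ell\ge 2$ and $n\ge 1$, define the finite set $$\operatorname{Mis}(\ell,n)=\{z\in\mathbb{C} : q_{\ell,n}(z)=0,\ q_{\ell-1,n}(z)\neq 0,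 \text{ and } q_{\ell,k}(z)\ne 0 \text{ for all } k\in \operatorname{Div}(n)^\ast\}$$ and the polynomial $m_{\ell,n}(z)=\prod_{r\in \operatorname{Mis}(\ell,n)}(z-r)$. The products defining $h_n$ and $m_{\ell,n}$ are over sets (each element taken once). Empty products are equal to $1$; in particular $\prod_{j=2}^{\ell}$ equals $1$ when $\ell\in\{0,1\}$. The floor function is $\lfloor x\rfloor = N$ for $N\in\mathbb{Z}$ and $x\in[N,N+1)$ (so for $\ell=0$, $\lfloor -1/k\rfloor=-1$). *)

theory Defs
  imports Complex_Main "HOL-Computational_Algebra.Polynomial"
begin

text \<open>The formal variable \<open>z\<close> is the polynomial \<open>[:0, 1:]\<close>.\<close>

fun quad_p :: "nat \<Rightarrow> int poly" where
  "quad_p 0 = 0"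
| "quad_p (Suc n) = (quad_p n)\<^sup>2 + [:0, 1:]"

definition quad_q :: "nat \<Rightarrow> nat \<Rightarrow> int poly" where
  "quad_q l n = quad_p (l + n) - quad_p l"

abbreviation complex_poly :: "int poly \<Rightarrow> complex poly" where
  "complex_poly f \<equiv> map_poly of_int f"

definition proper_divisors :: "nat \<Rightarrow> nat set" where
  "proper_divisors n = {k. 0 < k \<and> k dvd n \<and> k \<noteq> n}"

definition Hyp :: "nat \<Rightarrow> complex set" where
  "Hyp n = {z. poly (complex_poly (quad_p n)) z = 0 \<and>
               (\<forall>k \<in> proper_divisors n. poly (complex_poly (quad_p k)) z \<noteq> 0)}"

definition hyp_poly :: "nat \<Rightarrow> complex poly" where
  "hyp_poly n = (\<Prod>r\<in>Hyp n. [:- r, 1:])"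

text \<open>The next two definitions are meant for \<open>l \<ge> 2\<close> and \<open>n \<ge> 1\<close>, so \<open>l - 1\<close> is not truncated.\<close>

definition Mis :: "nat \<Rightarrow> nat \<Rightarrow> complex set" where
  "Mis l n = {z. poly (complex_poly (quad_q l n)) z = 0 \<and>
                 poly (complex_poly (quad_q (l - 1) n)) z \<noteq> 0 \<and>
                 (\<forall>k \<in> proper_divisors n. poly (complex_poly (quad_q l k)) z \<noteq> 0)}"

definition mis_poly :: "nat \<Rightarrow> nat \<Rightarrow> complex poly" where
  "mis_poly l n = (\<Prod>r\<in>Mis l n. [:- r, 1:])"

text \<open>The subtraction is in \<open>real\<close>, so that \<open>eta 0 k = \<lfloor>- 1 / k\<rfloor> + 2 = 1\<close>.\<close>

definition eta :: "nat \<Rightarrow> nat \<Rightarrow> int" where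
  "eta l k = \<lfloor>(real l - 1) / real k\<rfloor> + 2"

text \<open>The exponent is positive, so converting it with \<open>nat\<close> loses nothing.\<close>

lemma eta_ge_1:
  assumes "k \<ge> 1"
  shows "eta l k \<ge> 1"
proof -
  have "- 1 \<le> (real l - 1) / real k"
    using assms by (simp add: field_simps)
  then have "- 1 \<le> \<lfloor>(real l - 1) / real k\<rfloor>"
    by (simp add: le_floor_iff)
  then show ?thesis
    by (simp add: eta_def)
qed

text \<open>The root sets are finite, so the products over them are not the default value \<open>1\<close>
  that \<open>prod\<close> takes on infinite sets.\<close>

lemma degree_quad_p: "degree (quad_p (Suc n)) = 2 ^ n"
proof (induction n)
  case (Suc n)
  have "quad_p (Suc n) \<noteq> 0"
    using Suc.IH by (metis degree_0 power_not_zero zero_neq_numeral)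
  then have "degree ((quad_p (Suc n))\<^sup>2) = 2 ^ Suc n"
    using Suc.IH by (simp add: degree_power_eq del: quad_p.simps)
  moreover have "degree ([:0, 1:] :: int poly) < 2 ^ Suc n"
    using one_less_power[of "2::nat" "Suc n"] by simp
  ultimately show ?case
    by (simp only: quad_p.simps(2)[of "Suc n"] degree_add_eq_left)
qed simp

lemma quad_q_nonzero:
  assumes "n \<ge> 1"
  shows "quad_q l n \<noteq> 0"
proof
  assume "quad_q l n = 0"
  then have eq: "degree (quad_p (l + n)) = degree (quad_p l)"
    by (simp add: quad_q_def)
  obtain m where m: "n = Suc m"
    using assms by (cases n) auto
  show False
  proof (cases l)
    case 0
    then show False
      using eq m degree_quad_p[of m] by (simp del: quad_p.simps(2))
  next
    case (Suc i)
    then have "(2::nat) ^ (i + n) = 2 ^ i"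
      using eq degree_quad_p[of "i + n"] degree_quad_p[of i] by (simp del: quad_p.simps)
    then show False
      using assms by simp
  qed
qed

lemma finite_roots_complex_poly:
  assumes "f \<noteq> 0"
  shows "finite {z. poly (complex_poly f) z = 0}"
proof -
  have "complex_poly f \<noteq> 0"
    using assms by (simp add: map_poly_eq_0_iff)
  then show ?thesis
    by (rule poly_roots_finite)
qed

lemma finite_Mis:
  assumes "n \<ge> 1"
  shows "finite (Mis l n)"
  by (rule finite_subset[OF _ finite_roots_complex_poly[OF quad_q_nonzero[OF assms, of l]]])
     (auto simp: Mis_def)

lemma finite_Hyp:
  assumes "n \<ge> 1"
  shows "finite (Hyp n)"
  by (rule finite_subset[OF _ finite_roots_complex_poly[OF quad_q_nonzero[OF assms, of 0]]])
     (auto simp: Hyp_def quad_q_def)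

end

theory Submission
  imports Defs "HOL-Library.Z2"
    "HOL-Computational_Algebra.Fundamental_Theorem_Algebra"
begin

text \<open>Since \<open>q\<^sub>l\<^sub>+\<^sub>1\<^sub>,\<^sub>n = q\<^sub>l\<^sub>,\<^sub>n (p\<^sub>l\<^sub>+\<^sub>n + p\<^sub>l)\<close>, the polynomial \<open>q\<^sub>l\<^sub>,\<^sub>n\<close> is \<open>p\<^sub>n\<close> times the
  product of the factors \<open>s\<^sub>m = p\<^sub>m\<^sub>+\<^sub>n + p\<^sub>m\<close> for \<open>m < l\<close>. An argument modulo 2 shows that every
  factor has simple roots, so the order of \<open>z\<close> in \<open>q\<^sub>l\<^sub>,\<^sub>n\<close> counts the factors vanishing at \<open>z\<close>.
  If 0 has period \<open>k\<close> under \<open>w \<mapsto> w\<^sup>2 + z\<close>, then \<open>s\<^sub>m(z) = 2 p\<^sub>m(z)\<close> vanishes exactly when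
  \<open>k\<close> divides \<open>m\<close>; if 0 has preperiod \<open>j \<ge> 2\<close>, only \<open>s\<^sub>j\<^sub>-\<^sub>1\<close> vanishes.\<close>

section \<open>Integer polynomials modulo 2\<close>

lemma map_poly_of_int_add:
  "map_poly of_int (p + q) = (map_poly of_int p + map_poly of_int q :: 'a :: comm_ring_1 poly)"
  by (rule poly_eqI) (simp add: coeff_map_poly)

lemma map_poly_of_int_diff:
  "map_poly of_int (p - q) = (map_poly of_int p - map_poly of_int q :: 'a :: comm_ring_1 poly)"
  by (rule poly_eqI) (simp add: coeff_map_poly)

lemma map_poly_of_int_mult:
  "map_poly of_int (p * q) = (map_poly of_int p * map_poly of_int q :: 'a :: comm_ring_1 poly)"
  by (rule poly_eqI) (simp add: coeff_map_poly coeff_mult)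

lemma map_poly_of_int_pderiv:
  "map_poly of_int (pderiv p) = (pderiv (map_poly of_int p) :: complex poly)"
  by (rule poly_eqI) (simp add: coeff_map_poly coeff_pderiv)

lemmas map_poly_of_int_hom = map_poly_of_int_add map_poly_of_int_diff map_poly_of_int_mult

text \<open>Gauss's lemma turns the annihilator of \<open>z\<close> into a principal ideal.\<close>

lemma primitive_minimal_polynomial:
  fixes z :: complex
  assumes "f \<noteq> 0" and "poly (complex_poly f) z = 0"
  obtains g where "g \<noteq> 0" and "poly (complex_poly g) z = 0"
    and "\<And>h. poly (complex_poly h) z = 0 \<Longrightarrow> g dvd h"
proof -
  define P where "P g \<longleftrightarrow> g \<noteq> 0 \<and> poly (complex_poly g) z = 0" for g
  obtain g0 where g0: "P g0" and min: "\<And>h. P h \<Longrightarrow> degree g0 \<le> degree h"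
    using ex_has_least_nat[of P f degree] assms P_def by blast
  define g where "g = primitive_part g0"
  have g0_eq: "g0 = [:content g0:] * g"
    by (simp add: g_def)
  have g_nz: "g \<noteq> 0" and content_g: "content g = 1" and deg: "degree g = degree g0"
    using g0 by (auto simp: g_def P_def)
  have "poly (complex_poly g0) z = of_int (content g0) * poly (complex_poly g) z"
    by (subst g0_eq, simp only: map_poly_of_int_mult) (simp add: map_poly_pCons)
  then have g_root: "poly (complex_poly g) z = 0"
    using g0 by (auto simp: P_def)
  have "g dvd h" if h: "poly (complex_poly h) z = 0" for h
  proof -
    obtain q r where qr: "pseudo_divmod h g = (q, r)"
      by fastforce
    define c where "c = coeff g (degree g) ^ (Suc (degree h) - degree g)"
    have c_nz: "c \<noteq> 0"
      using g_nz by (simp add: c_def)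
    have eq: "smult c h = g * q + r" and r: "r = 0 \<or> degree r < degree g"
      using pseudo_divmod[OF g_nz qr] by (simp_all add: c_def)
    have "r = [:c:] * h - g * q"
      using eq by simp
    then have "poly (complex_poly r) z = 0"
      using h g_root by (simp only: map_poly_of_int_hom) simp
    then have "r = 0"
      using r min[of r] deg by (metis P_def not_less)
    then have eq: "smult c h = g * q"
      using eq by simp
    \<comment> \<open>Because \<open>g\<close> is primitive, the factor \<open>c\<close> introduced
      by pseudo-division divides the content of \<open>q\<close> and can be cancelled.\<close>
    then have "content q = content (smult c h)"
      using content_g by (simp add: content_mult)
    then have "[:c:] dvd q"
      by (simp add: const_poly_dvd_iff_dvd_content)
    then obtain q' where "q = smult c q'"
      by (auto elim: dvdE)
    then have "smult c h = smult c (g * q')"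
      using eq by simp
    then have "h = g * q'"
      using c_nz by (metis smult_cancel)
    then show ?thesis
      by simp
  qed
  then show thesis
    using that g_nz g_root by blast
qed

text \<open>A generator \<open>g\<close> of the annihilator of \<open>z\<close> would divide both
  polynomials. Modulo 2 it divides 1, so its reduction is constant; its leading coefficient divides
  that of the monic \<open>f\<close>, hence is odd and survives the reduction. So \<open>g\<close>
  is a nonzero constant, which has no root.\<close>

lemma monic_no_common_root_odd:
  fixes z :: complex
  assumes monic: "lead_coeff f = 1" and root: "poly (complex_poly f) z = 0"
  shows "poly (complex_poly (1 + 2 * w)) z \<noteq> 0"
proof
  assume odd_root: "poly (complex_poly (1 + 2 * w)) z = 0"
  have "f \<noteq> 0"
    using monic by auto
  then obtain g where g: "g \<noteq> 0" "poly (complex_poly g) z = 0" "g dvd f" "g dvd 1 + 2 * w"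
    using primitive_minimal_polynomial[OF _ root] root odd_root by metis
  let ?r = "map_poly of_int :: int poly \<Rightarrow> bit poly"
  have "?r (1 + (w + w)) = ?r 1 + (?r w + ?r w)"
    by (simp only: map_poly_of_int_add)
  also have "?r w + ?r w = 0"
    using mult_2[where 'a = bit] by (intro poly_eqI) (metis bit_2_eq_0 coeff_0 coeff_add mult_zero_left)
  finally have "?r (1 + 2 * w) = 1"
    unfolding mult_2 by simp
  moreover obtain u where "1 + 2 * w = g * u"
    using g(4) by (rule dvdE)
  ultimately have "1 = ?r g * ?r u"
    by (simp only: map_poly_of_int_mult)
  then have "?r g dvd 1"
    by (rule dvdI)
  then have deg: "degree (?r g) = 0"
    by (auto simp: is_unit_poly_iff)
  obtain h where "f = g * h"
    using g(3) by (auto elim: dvdE)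
  then have "lead_coeff g * lead_coeff h = 1"
    using monic by (simp add: lead_coeff_mult)
  then have lc: "lead_coeff g dvd 1"
    by (metis dvd_triv_left)
  then have "odd (lead_coeff g)"
    by (metis dvd_trans odd_one)
  then have "coeff (?r g) (degree g) \<noteq> 0"
    by (auto simp: coeff_map_poly elim!: oddE)
  then have "degree g = 0"
    using deg le_degree[of "?r g" "degree g"] by simp
  then obtain a where "g = [:a:]"
    by (rule degree_eq_zeroE)
  then show False
    using g by (simp add: map_poly_pCons)
qed

section \<open>Simplicity of the roots of \<open>p\<^sub>m\<^sub>+\<^sub>n + p\<^sub>m\<close>\<close>

lemma lead_coeff_quad_p: "lead_coeff (quad_p (Suc n)) = 1"
proof (induction n)
  case (Suc n)
  have "degree ((quad_p (Suc n))\<^sup>2) = 2 ^ Suc n"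
    using degree_quad_p[of n] Suc.IH
    by (subst degree_power_eq) (auto simp del: quad_p.simps)
  moreover have "degree ([:0, 1:] :: int poly) < 2 ^ Suc n"
    using one_less_power[of "2::nat" "Suc n"] by simp
  ultimately have "lead_coeff ((quad_p (Suc n))\<^sup>2 + [:0, 1:]) = lead_coeff ((quad_p (Suc n))\<^sup>2)"
    by (metis add.commute lead_coeff_add_le)
  then show ?case
    using Suc.IH by (simp only: quad_p.simps(2)[of "Suc n"] lead_coeff_power power_one)
qed simp

lemma lead_coeff_quad_p_add:
  assumes "n \<ge> 1"
  shows "lead_coeff (quad_p (m + n) + quad_p m) = 1"
proof -
  obtain i where i: "m + n = Suc i"
    using assms by (cases "m + n") auto
  have "degree (quad_p m) < degree (quad_p (m + n))"
  proof (cases m)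
    case 0
    then show ?thesis
      using i degree_quad_p[of i] by (simp del: quad_p.simps(2))
  next
    case (Suc j)
    then show ?thesis
      using i assms degree_quad_p[of i] degree_quad_p[of j] by (simp del: quad_p.simps(2))
  qed
  then show ?thesis
    using lead_coeff_quad_p[of i] i by (metis add.commute lead_coeff_add_le)
qed

lemma pderiv_quad_p_Suc:
  "pderiv (quad_p (Suc n)) = 1 + 2 * (quad_p n * pderiv (quad_p n))"
  by (simp add: power2_eq_square pderiv_add pderiv_mult pderiv_pCons)

text \<open>For positive \<open>n\<close> the derivative is congruent to 1 modulo 2; for
  \<open>n = 0\<close> both sides vanish with \<open>w = 0\<close>.\<close>

lemma pderiv_quad_p_odd: "\<exists>w. quad_p n * pderiv (quad_p n) = quad_p n + 2 * w"
proof (cases n)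
  case (Suc i)
  have "quad_p n * pderiv (quad_p n)
      = quad_p n + 2 * (quad_p n * (quad_p i * pderiv (quad_p i)))"
    unfolding Suc pderiv_quad_p_Suc by (simp only: algebra_simps)
  then show ?thesis ..
qed (auto intro: exI[of _ 0])

text \<open>Modulo 2, the half derivative \<open>t\<close> of \<open>s = a\<^sup>2 + b\<^sup>2 + 2z\<close> is \<open>1 + a + b\<close>,
  so \<open>t\<^sup>2 - s\<close> is congruent to 1.\<close>

lemma pderiv_quad_p_add:
  "\<exists>t w. pderiv (quad_p (Suc i) + quad_p (Suc j)) = 2 * t
     \<and> t\<^sup>2 - (quad_p (Suc i) + quad_p (Suc j)) = 1 + 2 * w"
proof -
  obtain v where v: "quad_p i * pderiv (quad_p i) = quad_p i + 2 * v"
    using pderiv_quad_p_odd by blast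
  obtain u where u: "quad_p j * pderiv (quad_p j) = quad_p j + 2 * u"
    using pderiv_quad_p_odd by blast
  define a where "a = quad_p i"
  define b where "b = quad_p j"
  define x :: "int poly" where "x = [:0, 1:]"
  define c where "c = u + v"
  define t where "t = 1 + a + b + 2 * c"
  have "pderiv (quad_p (Suc i) + quad_p (Suc j)) = 2 * t"
    by (simp only: pderiv_add pderiv_quad_p_Suc u v t_def c_def a_def b_def) (simp add: algebra_simps)
  moreover have "t\<^sup>2 - (quad_p (Suc i) + quad_p (Suc j)) = t\<^sup>2 - (a\<^sup>2 + x + (b\<^sup>2 + x))"
    by (simp add: a_def b_def x_def)
  moreover have "\<dots> = 1 + 2 * (a + b + a * b - x + 2 * c * (1 + a + b) + 2 * c\<^sup>2)"
    unfolding t_def by (simp add: power2_eq_square algebra_simps)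
  ultimately show ?thesis
    by metis
qed

text \<open>A multiple root would be shared by the monic sum \<open>s\<close> and an odd polynomial.
  For \<open>m = 0\<close> the derivative itself is odd. For positive \<open>m\<close> the two
  constant terms 1 add up to 2, so the derivative is \<open>2 * t\<close>, and
  \<open>t\<^sup>2 - s\<close> serves instead.\<close>

lemma pderiv_quad_p_add_root:
  fixes z :: complex
  assumes n: "n \<ge> 1" and root: "poly (complex_poly (quad_p (m + n) + quad_p m)) z = 0"
  shows "poly (pderiv (complex_poly (quad_p (m + n) + quad_p m))) z \<noteq> 0"
proof -
  define s where "s = quad_p (m + n) + quad_p m"
  have no_root: "poly (complex_poly (1 + 2 * w)) z \<noteq> 0" for w
    using monic_no_common_root_odd[OF lead_coeff_quad_p_add[OF n] root] .
  have "poly (complex_poly (pderiv s)) z \<noteq> 0"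
  proof (cases m)
    case 0
    obtain i where "n = Suc i"
      using n by (cases n) auto
    with 0 have "pderiv s = 1 + 2 * (quad_p i * pderiv (quad_p i))"
      using pderiv_quad_p_Suc[of i] by (simp add: s_def del: quad_p.simps(2))
    then show ?thesis
      using no_root by simp
  next
    case (Suc j)
    obtain t w where t: "pderiv s = 2 * t" and w: "t\<^sup>2 - s = 1 + 2 * w"
      using pderiv_quad_p_add[of "j + n" j] Suc by (auto simp: s_def simp del: quad_p.simps)
    have "poly (complex_poly t) z \<noteq> 0"
    proof
      assume "poly (complex_poly t) z = 0"
      then have "poly (complex_poly (t\<^sup>2 - s)) z = 0"
        using root by (simp only: map_poly_of_int_hom power2_eq_square s_def) simp
      then show False
        using w no_root by simp
    qed
    moreover have "poly (complex_poly (2 * t)) z = 2 * poly (complex_poly t) z"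
      by (simp only: mult_2 map_poly_of_int_hom poly_add)
    ultimately show ?thesis
      using t by simp
  qed
  then show ?thesis
    by (simp add: map_poly_of_int_pderiv s_def)
qed

lemma order_quad_p_add:
  fixes z :: complex
  assumes "n \<ge> 1"
  shows "order z (complex_poly (quad_p (m + n) + quad_p m))
    = (if poly (complex_poly (quad_p (m + n) + quad_p m)) z = 0 then 1 else 0)"
proof (cases "poly (complex_poly (quad_p (m + n) + quad_p m)) z = 0")
  case True
  let ?s = "complex_poly (quad_p (m + n) + quad_p m)"
  have deriv: "poly (pderiv ?s) z \<noteq> 0"
    using pderiv_quad_p_add_root[OF assms True] .
  then have "?s \<noteq> 0"
    by auto
  then have "order z ?s \<noteq> 0"
    using True by (simp add: order_root)
  then have "order z ?s = Suc (order z (pderiv ?s))"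
    using \<open>?s \<noteq> 0\<close> True by (intro order_pderiv)
  then show ?thesis
    using True deriv by (simp add: order_0I)
qed (simp add: order_0I)

section \<open>The critical orbit\<close>

lemma funpow_period_later:
  fixes f :: "'a \<Rightarrow> 'a"
  assumes "(f ^^ (i + k)) a = (f ^^ i) a" and "i \<le> j"
  shows "(f ^^ (j + k)) a = (f ^^ j) a"
proof -
  have shift: "(f ^^ (j - i)) ((f ^^ m) a) = (f ^^ (j - i + m)) a" for m
    by (simp add: funpow_add)
  have "(f ^^ (j + k)) a = (f ^^ (j - i)) ((f ^^ (i + k)) a)"
    unfolding shift using assms(2) by simp
  also have "\<dots> = (f ^^ j) a"
    unfolding assms(1) shift using assms(2) by simp
  finally show ?thesis .
qed

lemma funpow_period_mult:
  fixes f :: "'a \<Rightarrow> 'a"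
  assumes "(f ^^ (i + k)) a = (f ^^ i) a"
  shows "(f ^^ (i + k * m)) a = (f ^^ i) a"
proof (induction m)
  case (Suc m)
  have "(f ^^ (i + k * m + k)) a = (f ^^ (i + k * m)) a"
    using funpow_period_later[OF assms] by simp
  then show ?case
    using Suc by (simp add: algebra_simps)
qed simp

text \<open>The point at index \<open>i\<close> lies on the cycle, so any period observed anywhere
  along the orbit, before or after \<open>i\<close>, is also a period at \<open>i\<close>.\<close>

lemma funpow_period_earlier:
  fixes f :: "'a \<Rightarrow> 'a"
  assumes n: "(f ^^ (i + n)) a = (f ^^ i) a" "n \<ge> 1"
    and k: "(f ^^ (j + k)) a = (f ^^ j) a"
  shows "(f ^^ (i + k)) a = (f ^^ i) a"
proof -
  \<comment> \<open>Going \<open>j\<close> times around the cycle returns to the same point at an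
    index beyond \<open>j\<close>, where the period \<open>k\<close> is available.\<close>
  have "j \<le> i + n * j"
    using n(2) by (simp add: trans_le_add2)
  then have "(f ^^ (i + n * j + k)) a = (f ^^ (i + n * j)) a"
    using funpow_period_later[OF k] by simp
  also have "\<dots> = (f ^^ i) a"
    by (rule funpow_period_mult[OF n(1)])
  finally have "(f ^^ (i + k + n * j)) a = (f ^^ i) a"
    by (simp add: algebra_simps)
  moreover have "(f ^^ (i + k + n * j)) a = (f ^^ (i + k)) a"
    by (rule funpow_period_mult, rule funpow_period_later[OF n(1)]) simp
  ultimately show ?thesis
    by simp
qed

lemma funpow_period_gcd:
  fixes f :: "'a \<Rightarrow> 'a"
  assumes m: "(f ^^ (i + m)) a = (f ^^ i) a" "m \<ge> 1"
    and n: "(f ^^ (i + n)) a = (f ^^ i) a"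
  shows "(f ^^ (i + gcd m n)) a = (f ^^ i) a"
proof -
  \<comment> \<open>Bezout in subtraction-free form, so that only forward iteration occurs:
    \<open>n * y\<close> steps past \<open>i + gcd m n\<close> lead to
    \<open>i + m * x\<close>.\<close>
  obtain x y where xy: "m * x = n * y + gcd m n"
    using bezout_nat[of m n] m(2) by auto
  have "(f ^^ (i + gcd m n)) a = (f ^^ (i + gcd m n + n * y)) a"
    by (rule funpow_period_mult[symmetric], rule funpow_period_later[OF n]) simp
  also have "i + gcd m n + n * y = i + m * x"
    using xy by simp
  also have "(f ^^ (i + m * x)) a = (f ^^ i) a"
    by (rule funpow_period_mult[OF m(1)])
  finally show ?thesis .
qed

text \<open>The orbit of the critical point 0, written as an iteration so that the facts on periods
  of \<open>funpow\<close> apply; its terms are the values of \<open>quad_p\<close> at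
  \<open>z\<close>.\<close>

definition crit_orbit :: "complex \<Rightarrow> nat \<Rightarrow> complex" where
  "crit_orbit z n = ((\<lambda>w. w\<^sup>2 + z) ^^ n) 0"

lemma crit_orbit_0 [simp]: "crit_orbit z 0 = 0"
  by (simp add: crit_orbit_def)

lemma crit_orbit_Suc: "crit_orbit z (Suc n) = (crit_orbit z n)\<^sup>2 + z"
  by (simp add: crit_orbit_def)

lemmas crit_orbit_later =
  funpow_period_later[of _ _ "\<lambda>w. w\<^sup>2 + z" "0 :: complex" for z, folded crit_orbit_def]
lemmas crit_orbit_mult =
  funpow_period_mult[of _ _ "\<lambda>w. w\<^sup>2 + z" "0 :: complex" for z, folded crit_orbit_def]
lemmas crit_orbit_earlier =
  funpow_period_earlier[of _ _ "\<lambda>w. w\<^sup>2 + z" "0 :: complex" for z, folded crit_orbit_def]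
lemmas crit_orbit_gcd =
  funpow_period_gcd[of _ _ "\<lambda>w. w\<^sup>2 + z" "0 :: complex" for z, folded crit_orbit_def]

lemma poly_quad_p: "poly (complex_poly (quad_p n)) z = crit_orbit z n"
  by (induction n)
     (simp_all add: crit_orbit_Suc map_poly_of_int_hom power2_eq_square map_poly_pCons)

lemma poly_quad_q_eq_0_iff:
  "poly (complex_poly (quad_q l n)) z = 0 \<longleftrightarrow> crit_orbit z (l + n) = crit_orbit z l"
  by (simp add: quad_q_def map_poly_of_int_hom poly_quad_p)

section \<open>Multiplicity as a count of vanishing factors\<close>

lemma quad_q_Suc: "quad_q (Suc l) n = quad_q l n * (quad_p (l + n) + quad_p l)"
  by (simp add: quad_q_def power2_eq_square algebra_simps)

text \<open>Orders add over the factors split off by \<open>quad_q_Suc\<close>, each contributing 0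
  or 1. The polynomial \<open>quad_p n\<close> enters twice for positive \<open>l\<close>: as
  \<open>quad_q 0 n\<close>, giving the first summand, and as the factor with \<open>m = 0\<close>,
  counted in the set.\<close>

lemma order_quad_q:
  assumes "n \<ge> 1"
  shows "order z (complex_poly (quad_q l n)) = (if crit_orbit z n = 0 then 1 else 0)
    + card {m. m < l \<and> crit_orbit z (m + n) = - crit_orbit z m}"
proof (induction l)
  case 0
  have "quad_q 0 n = quad_p (0 + n) + quad_p 0"
    by (simp add: quad_q_def)
  then show ?case
    using order_quad_p_add[OF assms, of z 0] by (simp add: poly_quad_p)
next
  case (Suc l)
  let ?N = "\<lambda>l. {m. m < l \<and> crit_orbit z (m + n) = - crit_orbit z m}"
  have "?N (Suc l) = ?N l \<union> (if crit_orbit z (l + n) = - crit_orbit z l then {l} else {})"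
    by (auto simp: less_Suc_eq)
  then have "card (?N (Suc l))
      = card (?N l) + (if crit_orbit z (l + n) = - crit_orbit z l then 1 else 0)"
    by auto
  moreover have "complex_poly (quad_q (Suc l) n) \<noteq> 0"
    using quad_q_nonzero[OF assms] by (simp add: map_poly_eq_0_iff)
  ultimately show ?case
    using Suc order_quad_p_add[OF assms, of z l]
    by (simp add: quad_q_Suc map_poly_of_int_mult order_mult)
       (simp add: map_poly_of_int_add poly_quad_p eq_neg_iff_add_eq_0)
qed

section \<open>Hyperbolic and Misiurewicz parameters\<close>

text \<open>Membership means exact period \<open>k\<close>. The definition rules out proper divisors
  of \<open>k\<close> only, but a return at time \<open>n\<close> forces one at time
  \<open>gcd k n\<close>, which divides \<open>k\<close>.\<close>

lemma Hyp_iff: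
  assumes "k \<ge> 1"
  shows "z \<in> Hyp k \<longleftrightarrow> (\<forall>n. crit_orbit z n = 0 \<longleftrightarrow> k dvd n)"
proof
  assume z: "z \<in> Hyp k"
  then have k: "crit_orbit z k = 0"
    by (simp add: Hyp_def poly_quad_p)
  show "\<forall>n. crit_orbit z n = 0 \<longleftrightarrow> k dvd n"
  proof (intro allI iffI)
    fix n assume "crit_orbit z n = 0"
    then have "crit_orbit z (gcd k n) = 0"
      using crit_orbit_gcd[of z 0 k n] k assms by simp
    then have "gcd k n \<notin> proper_divisors k"
      using z by (auto simp: Hyp_def poly_quad_p)
    then have "gcd k n = k"
      using assms by (simp add: proper_divisors_def)
    then show "k dvd n"
      by (metis gcd_dvd2)
  next
    fix n assume "k dvd n"
    then show "crit_orbit z n = 0"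
      using crit_orbit_mult[of z 0 k] k by auto
  qed
next
  assume "\<forall>n. crit_orbit z n = 0 \<longleftrightarrow> k dvd n"
  then show "z \<in> Hyp k"
    by (auto simp: Hyp_def poly_quad_p proper_divisors_def dest: dvd_antisym)
qed

text \<open>Membership means exact preperiod \<open>j\<close> and exact period \<open>k\<close>. The
  bound on \<open>n\<close> excludes the trivial coincidence at \<open>n = 0\<close>.\<close>

lemma Mis_iff:
  assumes "k \<ge> 1" and "j \<ge> 2"
  shows "z \<in> Mis j k \<longleftrightarrow>
    (\<forall>i. \<forall>n\<ge>1. crit_orbit z (i + n) = crit_orbit z i \<longleftrightarrow> j \<le> i \<and> k dvd n)"
proof
  assume z: "z \<in> Mis j k"
  then have k: "crit_orbit z (j + k) = crit_orbit z j"
    by (simp add: Mis_def poly_quad_q_eq_0_iff)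
  show "\<forall>i. \<forall>n\<ge>1. crit_orbit z (i + n) = crit_orbit z i \<longleftrightarrow> j \<le> i \<and> k dvd n"
  proof (intro allI impI iffI conjI)
    fix i n :: nat
    assume n: "n \<ge> 1" and eq: "crit_orbit z (i + n) = crit_orbit z i"
    show "j \<le> i"
    proof (rule ccontr)
      assume "\<not> j \<le> i"
      \<comment> \<open>The definition only forbids period \<open>k\<close> at index
        \<open>j - 1\<close>, so the coincidence is first moved up to that index and then its period
        \<open>n\<close> is traded for \<open>k\<close>.\<close>
      then have "crit_orbit z (j - 1 + n) = crit_orbit z (j - 1)"
        using crit_orbit_later[OF eq, of "j - 1"] by linarith
      then have "crit_orbit z (j - 1 + k) = crit_orbit z (j - 1)"
        using n k by (rule crit_orbit_earlier)
      then show False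
        using z by (simp add: Mis_def poly_quad_q_eq_0_iff)
    qed
    have "crit_orbit z (j + n) = crit_orbit z j"
      using crit_orbit_earlier[OF k assms(1) eq] .
    then have "crit_orbit z (j + gcd k n) = crit_orbit z j"
      by (rule crit_orbit_gcd[OF k assms(1)])
    then have "gcd k n \<notin> proper_divisors k"
      using z by (auto simp: Mis_def poly_quad_q_eq_0_iff)
    then have "gcd k n = k"
      using assms by (simp add: proper_divisors_def)
    then show "k dvd n"
      by (metis gcd_dvd2)
  next
    fix i n :: nat
    assume "j \<le> i \<and> k dvd n"
    then show "crit_orbit z (i + n) = crit_orbit z i"
      using crit_orbit_mult[OF crit_orbit_later[OF k]] by auto
  qed
next
  assume *: "\<forall>i. \<forall>n\<ge>1. crit_orbit z (i + n) = crit_orbit z i \<longleftrightarrow> j \<le> i \<and> k dvd n"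
  have "crit_orbit z (j + k') \<noteq> crit_orbit z j" if "k' \<in> proper_divisors k" for k'
    using that *[rule_format, of k' j] by (auto simp: proper_divisors_def dest: dvd_antisym)
  then show "z \<in> Mis j k"
    using *[rule_format, of k j] *[rule_format, of k "j - 1"] assms
    by (auto simp: Mis_def poly_quad_q_eq_0_iff)
qed

lemma Hyp_disjoint:
  assumes "k \<ge> 1" "k' \<ge> 1" "z \<in> Hyp k" "z \<in> Hyp k'"
  shows "k = k'"
  using assms by (metis Hyp_iff dvd_antisym dvd_refl)

lemma Hyp_Mis_disjoint:
  assumes "k \<ge> 1" "k' \<ge> 1" "j \<ge> 2" "z \<in> Hyp k"
  shows "z \<notin> Mis j k'"
proof
  assume "z \<in> Mis j k'"
  moreover have "crit_orbit z (0 + k) = crit_orbit z 0"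
    using assms Hyp_iff[of k z] by simp
  ultimately have "j \<le> 0"
    using Mis_iff[of k' j z] assms by blast
  then show False
    using assms by simp
qed

text \<open>The coincidences of the critical orbit determine both preperiod and period.\<close>

lemma Mis_disjoint:
  assumes "k \<ge> 1" "k' \<ge> 1" "j \<ge> 2" "j' \<ge> 2" "z \<in> Mis j k" "z \<in> Mis j' k'"
  shows "j = j' \<and> k = k'"
proof -
  have "j \<le> i \<and> k dvd n \<longleftrightarrow> j' \<le> i \<and> k' dvd n" if "n \<ge> 1" for i n
    using assms that Mis_iff[of k j z] Mis_iff[of k' j' z] by blast
  from this[of k j] this[of k' j'] show ?thesis
    using assms by (auto dest: dvd_antisym)
qed

text \<open>The preperiod is never 1, since \<open>0\<close> is the only preimage of \<open>z\<close>.\<close>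

lemma quad_q_root_cases:
  assumes n: "n \<ge> 1" and root: "crit_orbit z (l + n) = crit_orbit z l"
  obtains k where "k dvd n" "z \<in> Hyp k"
  | k j where "k dvd n" "j \<in> {2..l}" "z \<in> Mis j k"
proof -
  \<comment> \<open>\<open>j\<close> is the preperiod, minimised for the fixed period
    \<open>n\<close>; \<open>k\<close> below is the least period at \<open>j\<close>.\<close>
  define j where "j = (LEAST j. crit_orbit z (j + n) = crit_orbit z j)"
  have jn: "crit_orbit z (j + n) = crit_orbit z j"
    unfolding j_def using root by (rule LeastI)
  have j_le: "j \<le> i" if "crit_orbit z (i + n) = crit_orbit z i" for i
    unfolding j_def using that by (rule Least_le)
  define k where "k = (LEAST k. k \<ge> 1 \<and> crit_orbit z (j + k) = crit_orbit z j)"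
  have k: "k \<ge> 1 \<and> crit_orbit z (j + k) = crit_orbit z j"
    unfolding k_def by (rule LeastI[where k = n]) (use n jn in simp)
  have k_le: "k \<le> m" if "m \<ge> 1" "crit_orbit z (j + m) = crit_orbit z j" for m
    unfolding k_def by (rule Least_le) (use that in simp)
  have k_dvd: "k dvd m" if "crit_orbit z (j + m) = crit_orbit z j" for m
  proof -
    have "crit_orbit z (j + gcd k m) = crit_orbit z j"
      using k that by (intro crit_orbit_gcd) auto
    then have "k \<le> gcd k m"
      using k by (intro k_le) (auto simp: Suc_le_eq)
    then have "gcd k m = k"
      using k by (intro antisym gcd_le1_nat) auto
    then show ?thesis
      by (metis gcd_dvd2)
  qed
  have "j \<noteq> 1"
  proof
    assume j: "j = 1"
    then have "crit_orbit z (Suc n) = crit_orbit z (Suc 0)"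
      using jn by simp
    then have "crit_orbit z n = 0"
      by (simp add: crit_orbit_Suc)
    then show False
      using j_le[of 0] j by simp
  qed
  then consider "j = 0" | "j \<ge> 2"
    by linarith
  then show thesis
  proof cases
    case 1
    have "crit_orbit z m = 0 \<longleftrightarrow> k dvd m" for m
      using 1 k k_dvd[of m] crit_orbit_mult[of z 0 k] by auto
    then show thesis
      using that(1)[of k] k_dvd[OF jn] k by (simp add: Hyp_iff)
  next
    case 2
    have "j \<le> i \<and> k dvd m \<longleftrightarrow> crit_orbit z (i + m) = crit_orbit z i" if "m \<ge> 1" for i m
    proof (intro iffI conjI)
      assume "j \<le> i \<and> k dvd m"
      then show "crit_orbit z (i + m) = crit_orbit z i"
        using k crit_orbit_mult[OF crit_orbit_later] by auto
    next
      assume eq: "crit_orbit z (i + m) = crit_orbit z i"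
      then have "crit_orbit z (j + m) = crit_orbit z j"
        by (rule crit_orbit_earlier[OF jn n])
      then show "k dvd m"
        by (rule k_dvd)
      \<comment> \<open>Minimality of \<open>j\<close> refers to the period \<open>n\<close>, so
        \<open>m\<close> is exchanged for \<open>n\<close> at index \<open>i\<close>.\<close>
      have "crit_orbit z (i + n) = crit_orbit z i"
        using crit_orbit_earlier[OF eq that jn] .
      then show "j \<le> i"
        by (rule j_le)
    qed
    then have "z \<in> Mis j k"
      using k 2 by (simp add: Mis_iff)
    then show thesis
      using that(2)[of k j] k_dvd[OF jn] 2 j_le[OF root] by simp
  qed
qed

section \<open>Multiplicities at hyperbolic and Misiurewicz points\<close>

lemma card_multiples_less:
  assumes "k \<ge> 1"
  shows "int (card {m. m < l \<and> k dvd m}) = eta l k - 1"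
proof (cases l)
  case 0
  have "\<lfloor>- 1 / real k\<rfloor> = - 1"
    using assms by (intro floor_unique) (auto simp: field_simps)
  then show ?thesis
    using 0 by (simp add: eta_def)
next
  case (Suc i)
  \<comment> \<open>The multiples of \<open>k\<close> up to \<open>i = l - 1\<close> include 0,
    which accounts for the successor in the cardinality.\<close>
  have "{m. m < l \<and> k dvd m} = (\<lambda>c. k * c) ` {..i div k}"
    using assms Suc
    by (auto simp: less_Suc_eq_le less_eq_div_iff_mult_less_eq mult.commute elim!: dvdE)
  moreover have "inj_on (\<lambda>c. k * c) {..i div k}"
    using assms by (auto intro: inj_onI)
  ultimately have "card {m. m < l \<and> k dvd m} = Suc (i div k)"
    by (simp add: card_image)
  moreover have "\<lfloor>real i / real k\<rfloor> = int (i div k)"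
    by (simp add: floor_divide_of_nat_eq)
  ultimately show ?thesis
    using Suc by (simp add: eta_def)
qed

lemma order_quad_q_Hyp:
  assumes n: "n \<ge> 1" and k: "k dvd n" and z: "z \<in> Hyp k"
  shows "int (order z (complex_poly (quad_q l n))) = eta l k"
proof -
  have k1: "k \<ge> 1"
    using n k by (cases k) auto
  have zero: "crit_orbit z i = 0 \<longleftrightarrow> k dvd i" for i
    using Hyp_iff[OF k1] z by blast
  have per: "crit_orbit z (m + n) = crit_orbit z m" for m
    using crit_orbit_later[of z 0 n m] zero[of n] k by simp
  \<comment> \<open>By periodicity the equation says that the value at \<open>m\<close> is its own
    negative, hence 0.\<close>
  have "crit_orbit z (m + n) = - crit_orbit z m \<longleftrightarrow> k dvd m" for m
    unfolding per zero[symmetric] by simp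
  then show ?thesis
    using order_quad_q[OF n, of z l] zero[of n] k card_multiples_less[OF k1, of l] by simp
qed

text \<open>Opposite values at \<open>m + n\<close> and \<open>m\<close> coincide after one more
  step, so \<open>j\<close> is at most \<open>Suc m\<close>. If \<open>j\<close> were at most
  \<open>m\<close>, the values would be equal as well as opposite, hence 0, but the orbit never
  returns to 0. Conversely, at \<open>m = j - 1\<close> the squares agree while the values
  differ.\<close>

lemma order_quad_q_Mis:
  assumes n: "n \<ge> 1" and k: "k dvd n" and j: "j \<in> {2..l}" and z: "z \<in> Mis j k"
  shows "order z (complex_poly (quad_q l n)) = 1"
proof -
  have k1: "k \<ge> 1"
    using n k by (cases k) auto
  have iff: "crit_orbit z (i + m) = crit_orbit z i \<longleftrightarrow> j \<le> i \<and> k dvd m" if "m \<ge> 1" for i m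
    using Mis_iff[OF k1, of j] j z that by auto
  have nz: "crit_orbit z m \<noteq> 0" if "m \<ge> 1" for m
    using iff[OF that, of 0] j by auto
  have "crit_orbit z (m + n) = - crit_orbit z m \<longleftrightarrow> m = j - 1" for m
  proof
    assume eq: "crit_orbit z (m + n) = - crit_orbit z m"
    then have "crit_orbit z (Suc m + n) = crit_orbit z (Suc m)"
      by (simp add: crit_orbit_Suc)
    then have "j \<le> Suc m"
      using iff[OF n] by blast
    moreover have "\<not> j \<le> m"
    proof
      assume "j \<le> m"
      then have "crit_orbit z (m + n) = crit_orbit z m"
        using iff[OF n] k by blast
      then show False
        using eq nz[of m] \<open>j \<le> m\<close> j by simp
    qed
    ultimately show "m = j - 1"
      by simp
  next
    assume m: "m = j - 1"
    then have "Suc m = j"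
      using j by simp
    then have "crit_orbit z (Suc m + n) = crit_orbit z (Suc m)"
      using iff[OF n, of "Suc m"] k by simp
    then have "(crit_orbit z (m + n))\<^sup>2 = (crit_orbit z m)\<^sup>2"
      by (simp add: crit_orbit_Suc)
    moreover have "crit_orbit z (m + n) \<noteq> crit_orbit z m"
      using iff[OF n, of m] m j by auto
    ultimately show "crit_orbit z (m + n) = - crit_orbit z m"
      by (simp add: power2_eq_iff)
  qed
  then have "{m. m < l \<and> crit_orbit z (m + n) = - crit_orbit z m} = {j - 1}"
    using j by auto
  then show ?thesis
    using order_quad_q[OF n, of z l] nz[OF n] by simp
qed

section \<open>Root set and factorization\<close>

lemma quad_q_root_set:
  assumes n: "n \<ge> 1"
  shows "{z. poly (complex_poly (quad_q l n)) z = 0} =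
    (\<Union>k \<in> {k. k dvd n}. Hyp k \<union> (\<Union>j \<in> {2..l}. Mis j k))"
proof (intro equalityI subsetI)
  fix z assume "z \<in> {z. poly (complex_poly (quad_q l n)) z = 0}"
  then have "crit_orbit z (l + n) = crit_orbit z l"
    by (simp add: poly_quad_q_eq_0_iff)
  then show "z \<in> (\<Union>k \<in> {k. k dvd n}. Hyp k \<union> (\<Union>j \<in> {2..l}. Mis j k))"
    by (rule quad_q_root_cases[OF n]) blast+
next
  fix z assume "z \<in> (\<Union>k \<in> {k. k dvd n}. Hyp k \<union> (\<Union>j \<in> {2..l}. Mis j k))"
  then obtain k where k: "k dvd n" and "z \<in> Hyp k \<or> (\<exists>j\<in>{2..l}. z \<in> Mis j k)"
    by blast
  moreover have "k \<ge> 1"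
    using n k by (cases k) auto
  \<comment> \<open>The multiplicities already computed are positive, which gives the root
    property.\<close>
  ultimately have "order z (complex_poly (quad_q l n)) \<noteq> 0"
    using order_quad_q_Hyp[OF n k, of z l] order_quad_q_Mis[OF n k, of _ l z] eta_ge_1[of k l]
    by fastforce
  then show "z \<in> {z. poly (complex_poly (quad_q l n)) z = 0}"
    by (auto simp: order_root)
qed

lemma lead_coeff_quad_q:
  assumes "n \<ge> 1"
  shows "lead_coeff (complex_poly (quad_q l n)) = 1"
proof (induction l)
  case 0
  then show ?case
    using lead_coeff_quad_p_add[OF assms, of 0]
    by (simp add: quad_q_def degree_map_poly coeff_map_poly)
next
  case (Suc l)
  have "lead_coeff (complex_poly (quad_p (l + n) + quad_p l)) = 1"
    using lead_coeff_quad_p_add[OF assms, of l] by (simp add: degree_map_poly coeff_map_poly)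
  then show ?case
    using Suc by (simp only: quad_q_Suc map_poly_of_int_mult lead_coeff_mult mult_1)
qed

text \<open>Over the complex numbers a monic polynomial is the product of its linear factors raised
  to their orders. The roots are grouped by the disjoint sets \<open>Hyp k\<close> and
  \<open>Mis j k\<close>, on each of which the order is constant.\<close>

lemma quad_q_factorization:
  assumes n: "n \<ge> 1"
  shows "complex_poly (quad_q l n) =
    (\<Prod>k | k dvd n. hyp_poly k ^ nat (eta l k) * (\<Prod>j = 2..l. mis_poly j k))"
proof -
  let ?q = "complex_poly (quad_q l n)"
  define g where "g z = [:- z, 1:] ^ order z ?q" for z
  let ?M = "\<lambda>k. \<Union>j\<in>{2..l}. Mis j k"
  have k1: "k \<ge> 1" if "k dvd n" for k
    using n that by (cases k) auto
  have fin: "finite {k. k dvd n}"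
    using n by simp
  have finM: "finite (?M k)" if "k dvd n" for k
    using k1[OF that] by (simp add: finite_Mis)
  have block: "hyp_poly k ^ nat (eta l k) * (\<Prod>j = 2..l. mis_poly j k) = prod g (Hyp k \<union> ?M k)"
    if k: "k dvd n" for k
  proof -
    have "g z = [:- z, 1:] ^ nat (eta l k)" if "z \<in> Hyp k" for z
      using order_quad_q_Hyp[OF n k that, of l] by (metis g_def nat_int)
    then have "hyp_poly k ^ nat (eta l k) = prod g (Hyp k)"
      by (simp add: hyp_poly_def prod_power_distrib)
    moreover have "mis_poly j k = prod g (Mis j k)" if "j \<in> {2..l}" for j
      using order_quad_q_Mis[OF n k that] by (simp add: g_def mis_poly_def)
    then have "(\<Prod>j = 2..l. mis_poly j k) = (\<Prod>j = 2..l. prod g (Mis j k))"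
      by (rule prod.cong[OF refl])
    moreover have "\<dots> = prod g (?M k)"
      by (rule prod.UNION_disjoint[symmetric])
         (use k1[OF k] Mis_disjoint in \<open>auto simp: finite_Mis\<close>)
    moreover have "prod g (Hyp k \<union> ?M k) = prod g (Hyp k) * prod g (?M k)"
      by (rule prod.union_disjoint)
         (use k1[OF k] finM[OF k] Hyp_Mis_disjoint in \<open>auto simp: finite_Hyp\<close>)
    ultimately show ?thesis
      by simp
  qed
  \<comment> \<open>Disjointness for different divisors ensures that no root is counted in two
    blocks.\<close>
  have disj: "(Hyp k \<union> ?M k) \<inter> (Hyp k' \<union> ?M k') = {}"
    if "k dvd n" "k' dvd n" "k \<noteq> k'" for k k'
    using that k1[OF that(1)] k1[OF that(2)] Hyp_disjoint Mis_disjoint Hyp_Mis_disjoint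
    by fastforce
  have "?q = prod g {z. poly ?q z = 0}"
    using complex_poly_decompose[of ?q] lead_coeff_quad_q[OF n, of l] by (simp add: g_def)
  also have "\<dots> = prod g (\<Union>k \<in> {k. k dvd n}. Hyp k \<union> ?M k)"
    by (simp only: quad_q_root_set[OF n])
  also have "\<dots> = (\<Prod>k | k dvd n. prod g (Hyp k \<union> ?M k))"
    by (rule prod.UNION_disjoint[OF fin]) (use k1 finM disj in \<open>auto simp: finite_Hyp\<close>)
  also have "\<dots> = (\<Prod>k | k dvd n. hyp_poly k ^ nat (eta l k) * (\<Prod>j = 2..l. mis_poly j k))"
    using block by (intro prod.cong) auto
  finally show ?thesis .
qed

theorem theorem2:
  fixes l n :: nat
  assumes "n \<ge> 1"
  shows "complex_poly (quad_q l n) =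
           (\<Prod>k | k dvd n. hyp_poly k ^ nat (eta l k) * (\<Prod>j = 2..l. mis_poly j k))
       \<and> {z. poly (complex_poly (quad_q l n)) z = 0} =
           (\<Union>k \<in> {k. k dvd n}. Hyp k \<union> (\<Union>j \<in> {2..l}. Mis j k))
       \<and> (\<forall>k. k dvd n \<longrightarrow>
            (\<forall>z \<in> Hyp k. int (order z (complex_poly (quad_q l n))) = eta l k))
       \<and> (\<forall>k. k dvd n \<longrightarrow>
            (\<forall>j \<in> {2..l}. \<forall>z \<in> Mis j k. order z (complex_poly (quad_q l n)) = 1))"
  using quad_q_factorization[OF assms] quad_q_root_set[OF assms]
    order_quad_q_Hyp[OF assms] order_quad_q_Mis[OF assms]
  by blast

end
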